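(* For any binary operation $\ast$ on $I=[0,1]$ and any $t$-norm $\vartriangle$ on $I$, there exist $f,g\in\mathbf{L}$ such that $f\star g\ne f\curlywedge g$, where $\curlywedge$ is the operation on $\mathbf{M}$ determined by $\ast$ and $\vartriangle$; i.e., $\star$ cannot be obtained by $\curlywedge$.
   Context: Let $I=[0,1]$, let $\mathbf{M}$ be the set of all functions $f:I\to I$, and let $\vee,\wedge$ be max and min on $I$. A function $f\in\mathbf{M}$ is normal if $\sup_{x\in I}f(x)=1$, and convex if $f(y)\ge f(x)\wedge f(z)$ whenever $0\le x\le y\le z\le 1$. $\mathbf{L}$ is the set of all normal and convex $f\in\mathbf{M}$. For $B\subseteq I$, $\mathbf{1}_B$ is the characteristic function of $B$. A $t$-norm on $I$ is a binary operation $I^2\to I$ that is commutative, associative, increasing in each argument, and has neutral element $1$. A binary operation $\ast$ on $I$ is an arbitrary map $I^2\to I$. Given $\ast$ and a $t$-norm $\vartriangle$, define for $f,g\in\mathbf{M}$ $$(f\curlywedge g)(x)=\sup\{f(y)\ast g(z)\mid y\vartriangle z=x\}.$$ For $f\in\mathbf{M}$: $f^L(x)=\sup\{f(y)\mid y\le x\}$ and $f^R(x)=\sup\{f(y)\mid y\ge x\}$. For $f,g\in\mathbf{L}$: $\eta_{f,g}=\inf\{x\in I\mid f^L(x)=1\}\wedge\inf\{x\in I\mid g^L(x)=1\}$, $\xi_{f,g}=\sup\{x\in I\mid f^R(x)=1\}\wedge\sup\{x\in I\mid g^R(x)=1\}$ (one has $\eta_{f,g}\le\xi_{f,g}$). The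 operation $\star:\mathbf{L}^2\to\mathbf{M}$: if $f=\mathbf{1}_{\{1\}}$ then $f\star g=g\star f=g$; if $g=\mathbf{1}_{\{1\}}$ then $f\star g=g\star f=f$; if $f\ne\mathbf{1}_{\{1\}}$ and $g\neq\mathbf{1}_{\{1\}}$ then $$(f\star g)(t)=\begin{cases} f^L(t)\vee g^L(t), & t\in[0,\eta_{f,g}),\\ 1,& t\in[\eta_{f,g},\xi_{f,g}),\\ f^R(\xi_{f,g})\wedge g^R(\xi_{f,g}), & t=\xi_{f,g},\\ 0,& t\in(\xi_{f,g},1].\end{cases}$$ *)

theory Defs
  imports Complex_Main "HOL-Library.FuncSet" "HOL-Library.Indicator_Function"
begin

abbreviation unit_I :: "real set" where
  "unit_I \<equiv> {0..1}"

text \<open>Maps from the unit interval to itself are extensional functions on the reals, so that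
  equality of two elements of \<open>fun_M\<close> is exactly pointwise equality on the unit interval.
  Every supremum or infimum below is taken in the reals; for arguments in \<open>fun_M\<close>
  (in \<open>fun_L\<close> for \<open>eta\<close> and \<open>xi\<close>) it ranges over a nonempty subset of the unit interval.\<close>

definition fun_M :: "(real \<Rightarrow> real) set" where
  "fun_M = unit_I \<rightarrow>\<^sub>E unit_I"

definition normal_fun :: "(real \<Rightarrow> real) \<Rightarrow> bool" where
  "normal_fun f \<longleftrightarrow> (SUP x\<in>unit_I. f x) = 1"

definition convex_fun :: "(real \<Rightarrow> real) \<Rightarrow> bool" where
  "convex_fun f \<longleftrightarrow>
     (\<forall>x y z. 0 \<le> x \<and> x \<le> y \<and> y \<le> z \<and> z \<le> 1 \<longrightarrow> f y \<ge> min (f x) (f z))"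

definition fun_L :: "(real \<Rightarrow> real) set" where
  "fun_L = {f \<in> fun_M. normal_fun f \<and> convex_fun f}"

definition char_fun :: "real set \<Rightarrow> real \<Rightarrow> real" where
  "char_fun B = restrict (indicator B) unit_I"

definition binary_op_I :: "(real \<Rightarrow> real \<Rightarrow> real) \<Rightarrow> bool" where
  "binary_op_I p \<longleftrightarrow> (\<forall>x\<in>unit_I. \<forall>y\<in>unit_I. p x y \<in> unit_I)"

definition t_norm :: "(real \<Rightarrow> real \<Rightarrow> real) \<Rightarrow> bool" where
  "t_norm T \<longleftrightarrow>
     binary_op_I T \<and>
     (\<forall>x\<in>unit_I. \<forall>y\<in>unit_I. T x y = T y x) \<and>
     (\<forall>x\<in>unit_I. \<forall>y\<in>unit_I. \<forall>z\<in>unit_I. T (T x y) z = T x (T y z)) \<and>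
     (\<forall>x\<in>unit_I. \<forall>y\<in>unit_I. \<forall>z\<in>unit_I. y \<le> z \<longrightarrow> T x y \<le> T x z) \<and>
     (\<forall>x\<in>unit_I. \<forall>y\<in>unit_I. \<forall>z\<in>unit_I. y \<le> z \<longrightarrow> T y x \<le> T z x) \<and>
     (\<forall>x\<in>unit_I. T x 1 = x \<and> T 1 x = x)"

text \<open>The index set in \<open>curlywedge\<close> is nonempty when \<open>T\<close> is a t-norm, since \<open>T x 1 = x\<close>.\<close>

definition curlywedge ::
  "(real \<Rightarrow> real \<Rightarrow> real) \<Rightarrow> (real \<Rightarrow> real \<Rightarrow> real) \<Rightarrow> (real \<Rightarrow> real) \<Rightarrow> (real \<Rightarrow> real) \<Rightarrow> real \<Rightarrow> real" where
  "curlywedge p T f g =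
     (\<lambda>x\<in>unit_I. Sup {p (f y) (g z) | y z. y \<in> unit_I \<and> z \<in> unit_I \<and> T y z = x})"

definition fun_left :: "(real \<Rightarrow> real) \<Rightarrow> real \<Rightarrow> real" where
  "fun_left f = (\<lambda>x\<in>unit_I. Sup {f y | y. y \<in> unit_I \<and> y \<le> x})"

definition fun_right :: "(real \<Rightarrow> real) \<Rightarrow> real \<Rightarrow> real" where
  "fun_right f = (\<lambda>x\<in>unit_I. Sup {f y | y. y \<in> unit_I \<and> y \<ge> x})"

definition eta :: "(real \<Rightarrow> real) \<Rightarrow> (real \<Rightarrow> real) \<Rightarrow> real" where
  "eta f g = min (Inf {x \<in> unit_I. fun_left f x = 1}) (Inf {x \<in> unit_I. fun_left g x = 1})"

definition xi :: "(real \<Rightarrow> real) \<Rightarrow> (real \<Rightarrow> real) \<Rightarrow> real" where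
  "xi f g = min (Sup {x \<in> unit_I. fun_right f x = 1}) (Sup {x \<in> unit_I. fun_right g x = 1})"

definition star :: "(real \<Rightarrow> real) \<Rightarrow> (real \<Rightarrow> real) \<Rightarrow> real \<Rightarrow> real" where
  "star f g =
     (if f = char_fun {1} then g
      else if g = char_fun {1} then f
      else (\<lambda>t\<in>unit_I.
        if t < eta f g then max (fun_left f t) (fun_left g t)
        else if t < xi f g then 1
        else if t = xi f g then min (fun_right f (xi f g)) (fun_right g (xi f g))
        else 0))"

end

theory Submission
  imports Defs
begin

text \<open>For a t-norm, \<open>y \<triangle> z = 1\<close> forces \<open>y = z = 1\<close>, so the value of \<open>f \<curlywedge> f\<close> at \<open>1\<close> is
  \<open>f 1 * f 1\<close> and depends on \<open>f\<close> only through \<open>f 1\<close>. For \<open>\<star>\<close> this fails: let \<open>f\<close> drop from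
  \<open>1\<close> to \<open>1/2\<close> at \<open>c\<close>. Then \<open>\<xi> = c\<close> and \<open>f 1 = 1/2\<close>, but \<open>(f \<star> f) 1\<close> is \<open>1/2\<close> for \<open>c = 1\<close> and
  \<open>0\<close> for \<open>c = 1/2\<close>.\<close>

text \<open>Monotonicity and the neutral element bound \<open>T y z\<close> by both \<open>y\<close>
  and \<open>z\<close>.\<close>

lemma t_norm_eq_1_iff:
  assumes "t_norm T" "y \<in> unit_I" "z \<in> unit_I"
  shows "T y z = 1 \<longleftrightarrow> y = 1 \<and> z = 1"
proof
  assume eq: "T y z = 1"
  have "(1::real) \<in> unit_I" "z \<le> 1" "y \<le> 1"
    using assms by auto
  then have "T y z \<le> T y 1" "T y z \<le> T 1 z" "T y 1 = y" "T 1 z = z"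
    using assms unfolding t_norm_def by blast+
  then show "y = 1 \<and> z = 1"
    using eq assms by auto
next
  assume "y = 1 \<and> z = 1"
  then show "T y z = 1"
    using assms by (simp add: t_norm_def)
qed

lemma curlywedge_at_1:
  assumes "t_norm T"
  shows "curlywedge p T f g 1 = p (f 1) (g 1)"
proof -
  have "{p (f y) (g z) | y z. y \<in> unit_I \<and> z \<in> unit_I \<and> T y z = 1} = {p (f 1) (g 1)}"
    by (auto simp: t_norm_eq_1_iff[OF assms] intro!: exI[of _ 1])
  then show ?thesis
    by (simp add: curlywedge_def)
qed

text \<open>The strict \<open><\<close> gives the value 1/2 at \<open>c\<close> itself, so that even
  \<open>c = 1\<close> yields 1/2 at 1.\<close>

definition step_fun :: "real \<Rightarrow> real \<Rightarrow> real" where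
  "step_fun c = (\<lambda>x\<in>unit_I. if x < c then 1 else 1/2)"

lemma step_fun_apply: "x \<in> unit_I \<Longrightarrow> step_fun c x = (if x < c then 1 else 1/2)"
  by (simp add: step_fun_def)

context
  fixes c :: real
  assumes c: "0 < c" "c \<le> 1"
begin

lemma step_fun_in_fun_L: "step_fun c \<in> fun_L"
proof -
  have "(SUP x\<in>unit_I. step_fun c x) = 1"
    by (rule cSup_eq_maximum) (use c in \<open>auto simp: step_fun_def image_iff intro!: bexI[of _ 0]\<close>)
  then show ?thesis
    by (auto simp: fun_L_def fun_M_def normal_fun_def convex_fun_def step_fun_def)
qed

lemma fun_left_step_fun:
  assumes "x \<in> unit_I"
  shows "fun_left (step_fun c) x = 1"
proof -
  have "Sup {step_fun c y | y. y \<in> unit_I \<and> y \<le> x} = 1"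
    by (rule cSup_eq_maximum) (use c assms in \<open>auto simp: step_fun_def intro!: exI[of _ 0]\<close>)
  then show ?thesis
    using assms by (simp add: fun_left_def)
qed

text \<open>The step decreases, so the supremum over \<open>y \<ge> x\<close> is attained at
  \<open>x\<close>.\<close>

lemma fun_right_step_fun:
  assumes "x \<in> unit_I"
  shows "fun_right (step_fun c) x = step_fun c x"
proof -
  have "Sup {step_fun c y | y. y \<in> unit_I \<and> y \<ge> x} = step_fun c x"
    by (rule cSup_eq_maximum) (use assms in \<open>auto simp: step_fun_def\<close>)
  then show ?thesis
    using assms by (simp add: fun_right_def)
qed

lemma eta_step_fun: "eta (step_fun c) (step_fun c) = 0"
proof -
  have "{x \<in> unit_I. fun_left (step_fun c) x = 1} = unit_I"
    using fun_left_step_fun by blast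
  then show ?thesis
    by (simp add: eta_def)
qed

lemma xi_step_fun: "xi (step_fun c) (step_fun c) = c"
proof -
  \<comment> \<open>The endpoint \<open>c\<close> is missing, yet it is still the supremum.\<close>
  have "{x \<in> unit_I. fun_right (step_fun c) x = 1} = {0..<c}"
    using c by (auto simp: fun_right_step_fun step_fun_apply split: if_splits)
  then show ?thesis
    using c by (simp add: xi_def)
qed

text \<open>Since \<open>eta\<close> is 0 and \<open>xi\<close> is \<open>c\<close>, the point 1
  either equals \<open>xi\<close> or lies beyond it.\<close>

lemma star_step_fun_at_1: "star (step_fun c) (step_fun c) 1 = (if c = 1 then 1/2 else 0)"
proof -
  have "step_fun c 0 \<noteq> char_fun {1} 0"
    using c by (simp add: step_fun_def char_fun_def)
  then have "step_fun c \<noteq> char_fun {1}"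
    by metis
  then show ?thesis
    using c eta_step_fun xi_step_fun fun_right_step_fun[of 1]
    by (auto simp: star_def step_fun_apply)
qed

end

theorem theorem5p2:
  fixes p T :: "real \<Rightarrow> real \<Rightarrow> real"
  assumes "binary_op_I p" and "t_norm T"
  shows "\<exists>f\<in>fun_L. \<exists>g\<in>fun_L. star f g \<noteq> curlywedge p T f g"
proof (rule ccontr)
  assume "\<not> ?thesis"
  \<comment> \<open>The right-hand side is free of \<open>c\<close>.\<close>
  then have "star (step_fun c) (step_fun c) 1 = p (1/2) (1/2)" if "0 < c" "c \<le> 1" for c
    using step_fun_in_fun_L[OF that] curlywedge_at_1[OF assms(2)] that
    by (simp add: step_fun_def)
  from this[of 1] this[of "1/2"] show False
    by (simp add: star_step_fun_at_1)
qed

end
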